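(* Let $G=(\Lambda\cup\{\rho\},E)$ be the complete graph with weights $W_e\ge0$, $e\in E$, such that $G_+=(\Lambda\cup\{\rho\},E_+)$, $E_+=\{e\in E:W_e>0\}$, is connected, and let $m_e\ge0$, $e\in E$. Let $e_1=\{x_1,y_1\},\dots,e_n=\{x_n,y_n\}$ be the edges $e\in E$ with $m_e>0$. Assume there are pairwise disjoint connected subsets $E_1,\dots,E_n$ of $E_+$ with $x_l,y_l\in\Lambda_{E_l}$ for $1\le l\le n$ ($e_l$ need not belong to $E_l$, and the vertex sets $\Lambda_{E_l}$ need not be pairwise disjoint). For $1\le l\le n$ let $\mathcal R^{G_l}(c,x_l\leftrightarrow y_l)$ be the effective resistance between $x_l$ and $y_l$ in the electrical network $G_l=(\Lambda_{E_l},E_l)$ with conductances $$c_e=\frac{W_{ij}\,e^{u_i+u_j}\,B_{x_ly_l}(u,s)}{e^{u_{x_l}+u_{y_l}}},\qquad e=\{i,j\}\in E_l .$$ Let $\delta_e\in(0,\infty]$, $e\in E$, be such that on the set $$U=\{(u,s)\in\mathbb R^\Lambda\times\mathbb R^\Lambda: B_e(u,s)<1+\delta_e\text{ for all }e\in E\}$$ one has $m_{e_l}\mathcal R^{G_l}(c,x_l\leftrightarrow y_l)<1$ for all $1\le l\le n$. Then on $U$ the matrix $D(u)-FMQ(u,s)F^t$ is positive definite and $$\det(\mathrm{Id}-M\mathcal G)\ge\prod_{l=1}^n\big(1-m_{e_l}\mathcal R^{G_l}(c,x_l\leftrightarrow y_l)\big).$$ Whenever $e_l$ is not a pinning edge,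 i.e. $\rho\notin e_l$, the term $\mathcal R^{G_l}(c,x_l\leftrightarrow y_l)$ in this product may be replaced by $\mathcal R^{G_l'}(c,x_l\leftrightarrow y_l)$, where $G_l'$ is obtained from $G_l$ by removing $\rho$ and all edges incident to it. Moreover, $\mathcal R^{G_l}(c,x_l\leftrightarrow y_l)$ is monotone decreasing in the conductances $c$: if $c'\ge c\ge0$ componentwise, then $\mathcal R^{G_l}(c',x_l\leftrightarrow y_l)\le\mathcal R^{G_l}(c,x_l\leftrightarrow y_l)$.
   Context: $\Lambda$ is a finite non-empty set, $\rho\notin\Lambda$, and $E$ is the set of all two-element subsets of $\Lambda\cup\{\rho\}$; $W_{ij}:=W_{\{i,j\}}$. For $(u,s)\in\mathbb R^\Lambda\times\mathbb R^\Lambda$ set $u_\rho=s_\rho=0$ and, for $e=\{i,j\}\in E$, $B_e=B_{ij}=\cosh(u_i-u_j)+\frac12(s_i-s_j)^2e^{u_i+u_j}$. For an edge set $\tilde E$, $\Lambda_{\tilde E}$ is the union of all edges in $\tilde E$ (the set of incident vertices); $\tilde E$ is called connected if the graph $(\Lambda_{\tilde E},\tilde E)$ is connected. Effective resistances between distinct vertices take values in $(0,\infty]$, with the usual convention that the value is $\infty$ if the two vertices are not connected by edges of positive conductance. Matrices (at $(u,s)$): give each $e\in E$ an arbitrary direction $e_+\to e_-$. $F\in\{-1,0,1\}^{\Lambda\times E}$, $F_{k,e}=1_{\{e_+=k\}}-1_{\{e_-=k\}}$. $\mathcal W=\mathrm{diag}(W_ee^{u_{e_+}+u_{e_-}},e\in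 E)$, $D=F\mathcal WF^t\in\mathbb R^{\Lambda\times\Lambda}$ (positive definite since $G_+$ is connected), $M=\mathrm{diag}(m_e,e\in E)$, $Q=\mathrm{diag}(Q_e,e\in E)$ with $Q_e=e^{u_{e_+}+u_{e_-}}/B_e(u,s)$, and $\mathcal G=\sqrt Q\,F^tD^{-1}F\sqrt Q\in\mathbb R^{E\times E}$.
   Formalization: Replacing the resistance in G_l by that in G_l' is unconditional for one term; for several terms at once it is claimed only if at most one replaced factor is negative, since two negative factors can make the product exceed the determinant. *)

theory Defs
  imports "HOL-Analysis.Analysis"
begin

section \<open>Finite simple graphs and effective resistances\<close>

text \<open>Edge sets are sets of two-element vertex sets.\<close>

definition edge_adj :: "'a set set \<Rightarrow> 'a rel" where
  "edge_adj A = {(i, j). {i, j} \<in> A}"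

definition graph_connected :: "'a set \<Rightarrow> 'a set set \<Rightarrow> bool" where
  "graph_connected V A \<longleftrightarrow> (\<forall>i\<in>V. \<forall>j\<in>V. (i, j) \<in> (edge_adj A)\<^sup>*)"

text \<open>Kirchhoff's and Ohm's laws: the potential \<open>v\<close> drives a unit current into the network
  \<open>(V, A)\<close> with conductances \<open>c\<close> at \<open>x\<close> and out of it at \<open>y\<close>.\<close>

definition unit_current_potential ::
  "'a set \<Rightarrow> 'a set set \<Rightarrow> ('a set \<Rightarrow> real) \<Rightarrow> 'a \<Rightarrow> 'a \<Rightarrow> ('a \<Rightarrow> real) \<Rightarrow> bool" where
  "unit_current_potential V A c x y v \<longleftrightarrow>
     (\<forall>k\<in>V. (\<Sum>j | j \<in> V \<and> {k, j} \<in> A. c {k, j} * (v k - v j)) =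
            (if k = x then 1 else 0) - (if k = y then 1 else 0))"

text \<open>For a finite network with nonnegative conductances, if \<open>x\<close> and \<open>y\<close> are joined by edges of
  positive conductance, such a potential exists and \<open>v x - v y\<close> does not depend on its choice.\<close>

definition eff_res ::
  "'a set \<Rightarrow> 'a set set \<Rightarrow> ('a set \<Rightarrow> real) \<Rightarrow> 'a \<Rightarrow> 'a \<Rightarrow> ereal" where
  "eff_res V A c x y =
     (if (x, y) \<in> (edge_adj {e \<in> A. 0 < c e})\<^sup>*
      then ereal (THE r. \<exists>v. unit_current_potential V A c x y v \<and> r = v x - v y)
      else \<infinity>)"

section \<open>The complete graph on \<open>\<Lambda> \<union> {\<rho>}\<close>\<close>

text \<open>\<open>\<Lambda>\<close> is the finite type \<open>'v\<close>; the vertices of the graph are the elements of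
  \<open>'v option\<close>, where \<open>Some i\<close> is the vertex \<open>i \<in> \<Lambda>\<close> and \<open>None\<close> is the pinning point \<open>\<rho>\<close>.\<close>

definition all_edges :: "'v option set set" where
  "all_edges = {e. card e = 2}"

definition pos_edges :: "('v option set \<Rightarrow> real) \<Rightarrow> 'v option set set" where
  "pos_edges W = {e \<in> all_edges. 0 < W e}"

text \<open>The edges as a type, so that they can index matrices.\<close>

typedef 'v edge = "all_edges :: 'v option set set"
  morphisms ends Edge
proof
  show "{None, Some undefined} \<in> all_edges"
    by (simp add: all_edges_def)
qed

instance edge :: (finite) finite
proof
  have "inj (ends :: 'a edge \<Rightarrow> 'a option set)"
    by (simp add: inj_on_def ends_inject)
  then show "finite (UNIV :: 'a edge set)"
    by (rule finite_imageD[rotated]) simp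
qed

text \<open>Extension by \<open>u\<^sub>\<rho> = 0\<close>.\<close>

definition ext :: "real ^ 'v \<Rightarrow> 'v option \<Rightarrow> real" where
  "ext u i = (case i of None \<Rightarrow> 0 | Some k \<Rightarrow> u $ k)"

definition B :: "real ^ 'v \<Rightarrow> real ^ 'v \<Rightarrow> 'v option \<Rightarrow> 'v option \<Rightarrow> real" where
  "B u s i j = cosh (ext u i - ext u j) + 1 / 2 * (ext s i - ext s j)\<^sup>2 * exp (ext u i + ext u j)"

definition U_set :: "('v option set \<Rightarrow> ereal) \<Rightarrow> ((real ^ 'v) \<times> (real ^ 'v)) set" where
  "U_set \<delta> = {(u, s). \<forall>i j. i \<noteq> j \<longrightarrow> ereal (B u s i j) < 1 + \<delta> {i, j}}"

text \<open>For \<open>e = {i, j}\<close> the exponent \<open>\<Sum>k\<in>e. ext u k\<close> is \<open>u\<^sub>i + u\<^sub>j\<close>.\<close>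

definition conductance ::
  "('v option set \<Rightarrow> real) \<Rightarrow> real ^ 'v \<Rightarrow> real ^ 'v \<Rightarrow> 'v option \<Rightarrow> 'v option
     \<Rightarrow> 'v option set \<Rightarrow> real" where
  "conductance W u s x y e =
     W e * exp (\<Sum>k\<in>e. ext u k) * B u s x y / exp (ext u x + ext u y)"

text \<open>The network \<open>G\<^sub>l\<close> carried by an edge set \<open>A\<close>, and \<open>G\<^sub>l'\<close>, which arises from it by deleting
  \<open>\<rho>\<close>.\<close>

definition res_G :: "'v option set set \<Rightarrow> ('v option set \<Rightarrow> real) \<Rightarrow> 'v option \<Rightarrow> 'v option \<Rightarrow> ereal" where
  "res_G A c x y = eff_res (\<Union>A) A c x y"

definition res_G' :: "'v option set set \<Rightarrow> ('v option set \<Rightarrow> real) \<Rightarrow> 'v option \<Rightarrow> 'v option \<Rightarrow> ereal" where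
  "res_G' A c x y = eff_res (\<Union>A - {None}) {e \<in> A. None \<notin> e} c x y"

section \<open>Matrices\<close>

definition diag :: "('n::finite \<Rightarrow> real) \<Rightarrow> real ^ 'n ^ 'n" where
  "diag f = (\<chi> i j. if i = j then f i else 0)"

definition pos_definite :: "real ^ 'n ^ 'n \<Rightarrow> bool" where
  "pos_definite A \<longleftrightarrow> transpose A = A \<and> (\<forall>v. v \<noteq> 0 \<longrightarrow> 0 < v \<bullet> (A *v v))"

text \<open>\<open>h\<close> and \<open>t\<close> give the direction \<open>e\<^sub>+ = h e\<close>, \<open>e\<^sub>- = t e\<close> of each edge \<open>e\<close>.\<close>

definition orientation :: "('v option set \<Rightarrow> 'v option) \<Rightarrow> ('v option set \<Rightarrow> 'v option) \<Rightarrow> bool" where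
  "orientation h t \<longleftrightarrow> (\<forall>e\<in>all_edges. e = {h e, t e})"

definition F_mat ::
  "('v::finite option set \<Rightarrow> 'v option) \<Rightarrow> ('v option set \<Rightarrow> 'v option) \<Rightarrow> real ^ 'v edge ^ 'v" where
  "F_mat h t = (\<chi> k e. (if h (ends e) = Some k then 1 else 0) - (if t (ends e) = Some k then 1 else 0))"

definition W_mat ::
  "('v::finite option set \<Rightarrow> 'v option) \<Rightarrow> ('v option set \<Rightarrow> 'v option) \<Rightarrow>
   ('v option set \<Rightarrow> real) \<Rightarrow> real ^ 'v \<Rightarrow> real ^ 'v edge ^ 'v edge" where
  "W_mat h t W u = diag (\<lambda>e. W (ends e) * exp (ext u (h (ends e)) + ext u (t (ends e))))"

definition D_mat ::
  "('v::finite option set \<Rightarrow> 'v option) \<Rightarrow> ('v option set \<Rightarrow> 'v option) \<Rightarrow>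
   ('v option set \<Rightarrow> real) \<Rightarrow> real ^ 'v \<Rightarrow> real ^ 'v ^ 'v" where
  "D_mat h t W u = F_mat h t ** W_mat h t W u ** transpose (F_mat h t)"

definition M_mat :: "('v::finite option set \<Rightarrow> real) \<Rightarrow> real ^ 'v edge ^ 'v edge" where
  "M_mat m = diag (\<lambda>e. m (ends e))"

definition Q_entry ::
  "('v::finite option set \<Rightarrow> 'v option) \<Rightarrow> ('v option set \<Rightarrow> 'v option) \<Rightarrow>
   real ^ 'v \<Rightarrow> real ^ 'v \<Rightarrow> 'v edge \<Rightarrow> real" where
  "Q_entry h t u s e =
     exp (ext u (h (ends e)) + ext u (t (ends e))) / B u s (h (ends e)) (t (ends e))"

definition Q_mat ::
  "('v::finite option set \<Rightarrow> 'v option) \<Rightarrow> ('v option set \<Rightarrow> 'v option) \<Rightarrow>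
   real ^ 'v \<Rightarrow> real ^ 'v \<Rightarrow> real ^ 'v edge ^ 'v edge" where
  "Q_mat h t u s = diag (Q_entry h t u s)"

definition sqrtQ_mat ::
  "('v::finite option set \<Rightarrow> 'v option) \<Rightarrow> ('v option set \<Rightarrow> 'v option) \<Rightarrow>
   real ^ 'v \<Rightarrow> real ^ 'v \<Rightarrow> real ^ 'v edge ^ 'v edge" where
  "sqrtQ_mat h t u s = diag (\<lambda>e. sqrt (Q_entry h t u s e))"

definition G_mat ::
  "('v::finite option set \<Rightarrow> 'v option) \<Rightarrow> ('v option set \<Rightarrow> 'v option) \<Rightarrow>
   ('v option set \<Rightarrow> real) \<Rightarrow> real ^ 'v \<Rightarrow> real ^ 'v \<Rightarrow> real ^ 'v edge ^ 'v edge" where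
  "G_mat h t W u s =
     sqrtQ_mat h t u s ** transpose (F_mat h t) ** matrix_inv (D_mat h t W u)
       ** F_mat h t ** sqrtQ_mat h t u s"

end

theory Submission
  imports Defs
begin

text \<open>Dirichlet's principle bounds \<open>(v\<^sub>x - v\<^sub>y)\<^sup>2\<close> by the effective resistance times the energy of
  \<open>v\<close> in the subnetwork. As the \<open>E\<^sub>l\<close> are disjoint, their energies add up to at most \<open>v \<bullet> D v\<close>, so
  subtracting the rank-one matrices \<open>m\<^sub>e Q\<^sub>e F\<^sub>e F\<^sub>e\<^sup>t\<close> from \<open>D\<close> one at a time keeps the matrix
  positive definite. Subtracting the one that belongs to \<open>e\<^sub>k\<close> from \<open>N\<close> multiplies the determinant by
  \<open>1 - m\<^sub>k Q\<^sub>k F\<^sub>k \<bullet> N\<inverse> F\<^sub>k\<close>, and \<open>N\<close> still dominates the energy of the untouched subnetwork \<open>E\<^sub>k\<close>,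
  so this factor is at least \<open>1 - m\<^sub>k R\<^sub>k\<close>.\<close>

section \<open>Energy and effective resistance\<close>

text \<open>Extending \<open>c\<close> by zero off \<open>A\<close> lets all sums run over the whole
  vertex type, so the energy carries no vertex set.\<close>

definition edge_weight :: "'a set set \<Rightarrow> ('a set \<Rightarrow> real) \<Rightarrow> 'a \<Rightarrow> 'a \<Rightarrow> real" where
  "edge_weight A c i j = (if {i, j} \<in> A then c {i, j} else 0)"

text \<open>The Dirichlet form. Ordered pairs meet each edge twice, hence the division by 2; it is
  kept bilinear because potentials get paired with arbitrary functions.\<close>

definition energy ::
  "'a::finite set set \<Rightarrow> ('a set \<Rightarrow> real) \<Rightarrow> ('a \<Rightarrow> real) \<Rightarrow> ('a \<Rightarrow> real) \<Rightarrow> real" where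
  "energy A c f g = (\<Sum>i\<in>UNIV. \<Sum>j\<in>UNIV. edge_weight A c i j * ((f i - f j) * (g i - g j))) / 2"

lemma edge_weight_commute: "edge_weight A c i j = edge_weight A c j i"
  by (simp add: edge_weight_def insert_commute)

lemma edge_weight_nonneg: "(\<And>e. e \<in> A \<Longrightarrow> 0 \<le> c e) \<Longrightarrow> 0 \<le> edge_weight A c i j"
  by (simp add: edge_weight_def)

lemma energy_commute: "energy A c f g = energy A c g f"
  by (simp add: energy_def mult.commute)

lemma energy_nonneg:
  assumes "\<And>e. e \<in> A \<Longrightarrow> 0 \<le> c e"
  shows "0 \<le> energy A c f f"
  unfolding energy_def using edge_weight_nonneg[of A c] assms by (auto intro!: sum_nonneg)

lemma energy_mono:
  assumes "A' \<subseteq> A" "\<And>e. e \<in> A \<Longrightarrow> 0 \<le> c' e" "\<And>e. e \<in> A' \<Longrightarrow> c e \<le> c' e"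
  shows "energy A' c f f \<le> energy A c' f f"
proof -
  have "edge_weight A' c i j \<le> edge_weight A c' i j" for i j
    using assms by (auto simp: edge_weight_def)
  then show ?thesis
    unfolding energy_def by (intro divide_right_mono sum_mono mult_right_mono) auto
qed

lemma energy_scale: "energy A (\<lambda>e. a * c e) f g = a * energy A c f g"
proof -
  have "edge_weight A (\<lambda>e. a * c e) i j = a * edge_weight A c i j" for i j
    by (simp add: edge_weight_def)
  then show ?thesis
    by (simp add: energy_def sum_distrib_left mult.assoc)
qed

lemma energy_cong: "(\<And>e. e \<in> A \<Longrightarrow> c e = c' e) \<Longrightarrow> energy A c f g = energy A c' f g"
proof -
  assume "\<And>e. e \<in> A \<Longrightarrow> c e = c' e"
  then have "edge_weight A c i j = edge_weight A c' i j" for i j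
    by (simp add: edge_weight_def)
  then show ?thesis
    by (simp add: energy_def)
qed

lemma energy_Cauchy_Schwarz:
  assumes "\<And>e. e \<in> A \<Longrightarrow> 0 \<le> c e"
  shows "(energy A c f g)\<^sup>2 \<le> energy A c f f * energy A c g g"
proof -
  \<comment> \<open>Square roots of the weights turn the energy into half an inner product of
    vectors indexed by ordered vertex pairs.\<close>
  define r where "r = (\<lambda>p. sqrt (edge_weight A c (fst p) (snd p)))"
  define d where "d = (\<lambda>(f::'a \<Rightarrow> real) p. f (fst p) - f (snd p))"
  have E: "energy A c f g = (\<Sum>p\<in>UNIV. (r p * d f p) * (r p * d g p)) / 2" for f g
  proof -
    have "edge_weight A c (fst p) (snd p) * (d f p * d g p) = (r p * d f p) * (r p * d g p)" for p
    proof -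
      have "r p * r p = edge_weight A c (fst p) (snd p)"
        using edge_weight_nonneg[of A c] assms by (simp add: r_def)
      then show ?thesis
        by (simp flip: \<open>r p * r p = _\<close>)
    qed
    moreover have "energy A c f g = (\<Sum>p\<in>UNIV. edge_weight A c (fst p) (snd p) * (d f p * d g p)) / 2"
      by (simp add: energy_def sum.cartesian_product d_def case_prod_beta)
    ultimately show ?thesis
      by presburger
  qed
  show ?thesis
    using Cauchy_Schwarz_ineq_sum[of "\<lambda>p. r p * d f p" "\<lambda>p. r p * d g p" UNIV]
    by (simp add: E power2_eq_square)
qed

section \<open>Green's identity and unit current potentials\<close>

text \<open>Summation by parts: swapping the indices and using the symmetry of the weights replaces
  \<open>f k\<close> by \<open>- f j\<close>, and the mean of both forms contains
  \<open>f k - f j\<close>. The inner sum is the Laplacian of \<open>v\<close>.\<close>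

lemma Green_identity:
  fixes f v :: "'a::finite \<Rightarrow> real"
  shows "(\<Sum>k\<in>UNIV. f k * (\<Sum>j\<in>UNIV. edge_weight A c k j * (v k - v j))) = energy A c f v"
proof -
  let ?S = "\<Sum>k\<in>UNIV. f k * (\<Sum>j\<in>UNIV. edge_weight A c k j * (v k - v j))"
  have "?S = (\<Sum>k\<in>UNIV. \<Sum>j\<in>UNIV. f k * (edge_weight A c k j * (v k - v j)))"
    by (simp add: sum_distrib_left)
  moreover have "?S = (\<Sum>k\<in>UNIV. \<Sum>j\<in>UNIV. - f j * (edge_weight A c k j * (v k - v j)))"
    unfolding sum_distrib_left
    by (subst sum.swap, intro sum.cong refl, subst edge_weight_commute) (simp add: algebra_simps)
  ultimately have "2 * ?S = (\<Sum>k\<in>UNIV. \<Sum>j\<in>UNIV. f k * (edge_weight A c k j * (v k - v j)))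
      + (\<Sum>k\<in>UNIV. \<Sum>j\<in>UNIV. - f j * (edge_weight A c k j * (v k - v j)))"
    by simp
  also have "\<dots> = 2 * energy A c f v"
    unfolding energy_def sum.distrib[symmetric] by (simp add: algebra_simps)
  finally show ?thesis by simp
qed

text \<open>A vertex outside \<open>V\<close> lies on no edge of \<open>A\<close> and is neither
  \<open>x\<close> nor \<open>y\<close>, so Kirchhoff's law there reads
  \<open>0 = 0\<close>.\<close>

lemma unit_current_potential_iff:
  fixes v :: "'a::finite \<Rightarrow> real"
  assumes "\<Union>A \<subseteq> V" "x \<in> V" "y \<in> V"
  shows "unit_current_potential V A c x y v \<longleftrightarrow>
    (\<forall>k. (\<Sum>j\<in>UNIV. edge_weight A c k j * (v k - v j)) = (if k = x then 1 else 0) - (if k = y then 1 else 0))"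
proof -
  have V: "{k, j} \<in> A \<Longrightarrow> k \<in> V \<and> j \<in> V" for k j
    using assms(1) by blast
  have S: "(\<Sum>j | j \<in> V \<and> {k, j} \<in> A. c {k, j} * (v k - v j))
      = (\<Sum>j\<in>UNIV. edge_weight A c k j * (v k - v j))" for k
    by (rule sum.mono_neutral_cong_left) (auto simp: edge_weight_def dest: V)
  have Z: "(\<Sum>j\<in>UNIV. edge_weight A c k j * (v k - v j)) = (if k = x then 1 else 0) - (if k = y then 1 else 0)"
    if "k \<notin> V" for k
  proof -
    have "(\<Sum>j\<in>UNIV. edge_weight A c k j * (v k - v j)) = 0"
      using that by (intro sum.neutral) (auto simp: edge_weight_def dest: V)
    moreover have "k \<noteq> x" "k \<noteq> y"
      using that assms(2,3) by auto
    ultimately show ?thesis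
      by simp
  qed
  show ?thesis
    unfolding unit_current_potential_def S by (intro iffI allI ballI) (use Z in blast)+
qed

text \<open>Green's identity pairs \<open>f\<close> with a unit source at \<open>x\<close> and a
  unit sink at \<open>y\<close>. For \<open>f = v\<close> it equates the energy of the potential
  with its drop.\<close>

lemma energy_potential:
  fixes v :: "'a::finite \<Rightarrow> real"
  assumes "\<Union>A \<subseteq> V" "x \<in> V" "y \<in> V" "unit_current_potential V A c x y v"
  shows "energy A c f v = f x - f y"
proof -
  have "energy A c f v = (\<Sum>k\<in>UNIV. f k * ((if k = x then 1 else 0) - (if k = y then 1 else 0)))"
    using assms(4) unfolding Green_identity[symmetric] unit_current_potential_iff[OF assms(1-3)] by simp
  also have "\<dots> = (\<Sum>k\<in>UNIV. (if k = x then f k else 0) - (if k = y then f k else 0))"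
    by (intro sum.cong) auto
  also have "\<dots> = f x - f y"
    by (simp add: sum_subtractf)
  finally show ?thesis .
qed

section \<open>Functions of zero energy and existence of potentials\<close>

lemma edge_adj_const:
  assumes "\<And>i j. {i, j} \<in> A \<Longrightarrow> f i = f j" "(x, y) \<in> (edge_adj A)\<^sup>*"
  shows "f x = f y"
  using assms(2)
proof (induction rule: rtrancl_induct)
  case (step z w)
  have "f z = f w"
    by (rule assms(1)) (use step.hyps(2) in \<open>simp add: edge_adj_def\<close>)
  then show ?case
    using step.IH by (rule trans[rotated])
qed (rule refl)

text \<open>All terms of the energy are nonnegative, so each one vanishes and \<open>f\<close>
  cannot jump along an edge of positive conductance.\<close>

lemma energy_eq_0_imp_eq:
  fixes f :: "'a::finite \<Rightarrow> real"
  assumes "\<And>e. e \<in> A \<Longrightarrow> 0 \<le> c e" "energy A c f f = 0" "(x, y) \<in> (edge_adj {e \<in> A. 0 < c e})\<^sup>*"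
  shows "f x = f y"
proof (rule edge_adj_const[OF _ assms(3)])
  fix i j assume ij: "{i, j} \<in> {e \<in> A. 0 < c e}"
  have nn: "0 \<le> edge_weight A c i j * ((f i - f j) * (f i - f j))" for i j
    using edge_weight_nonneg[of A c] assms(1) by simp
  have "(\<Sum>i\<in>UNIV. \<Sum>j\<in>UNIV. edge_weight A c i j * ((f i - f j) * (f i - f j))) = 0"
    using assms(2) by (simp add: energy_def)
  then have "edge_weight A c i j * ((f i - f j) * (f i - f j)) = 0"
    by (subst (asm) sum_nonneg_eq_0_iff, use nn in \<open>auto intro!: sum_nonneg\<close>)
       (subst (asm) sum_nonneg_eq_0_iff, use nn in auto)
  then show "f i = f j"
    using ij by (simp add: edge_weight_def)
qed

text \<open>The Laplacian is symmetric, so its range is the orthogonal complement of its kernel; functions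
  in the kernel are constant on connected components, hence orthogonal to the unit source at \<open>x\<close>
  with sink at \<open>y\<close>.\<close>

lemma unit_current_potential_exists:
  fixes c :: "'a::finite set \<Rightarrow> real"
  assumes "\<Union>A \<subseteq> V" "x \<in> V" "y \<in> V"
    and nn: "\<And>e. e \<in> A \<Longrightarrow> 0 \<le> c e" and conn: "(x, y) \<in> (edge_adj {e \<in> A. 0 < c e})\<^sup>*"
  obtains v where "unit_current_potential V A c x y v"
proof -
  define L :: "real^'a \<Rightarrow> real^'a"
    where "L = (\<lambda>v. \<chi> k. \<Sum>j\<in>UNIV. edge_weight A c k j * (v $ k - v $ j))"
  define b :: "real^'a" where "b = axis x 1 - axis y 1"
  have L_inner: "w \<bullet> L v = energy A c (($) w) (($) v)" for v w
    by (simp add: L_def inner_vec_def Green_identity)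
  have "linear L"
    by (rule linearI) (simp_all add: L_def vec_eq_iff sum.distrib[symmetric] sum_distrib_left algebra_simps)
  then have span_L: "span (range L) = range L"
    by (simp add: linear_subspace_image span_eq_iff)
  obtain p z where p: "p \<in> span (range L)" and z: "\<And>w. w \<in> span (range L) \<Longrightarrow> orthogonal z w"
    and b: "b = p + z"
    using orthogonal_subspace_decomp_exists[of "range L" b] by metis
  have "z \<bullet> L z = 0"
    using z[OF span_base[of "L z"]] by (simp add: orthogonal_def)
  then have "z $ x = z $ y"
    using energy_eq_0_imp_eq[of A c "($) z" x y] nn conn unfolding L_inner by blast
  then have "z \<bullet> b = 0"
    by (simp add: b_def inner_diff_right inner_axis)
  moreover have "z \<bullet> p = 0"
    using z[OF p] by (simp add: orthogonal_def)
  ultimately have "z = 0"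
    by (simp add: b inner_add_right)
  then obtain v where "b = L v"
    using p b span_L by auto
  then have "(\<Sum>j\<in>UNIV. edge_weight A c k j * (v $ k - v $ j)) = (if k = x then 1 else 0) - (if k = y then 1 else 0)" for k
    by (auto simp: L_def b_def vec_eq_iff axis_def dest: spec[of _ k])
  then show thesis
    using that[of "($) v"] by (simp add: unit_current_potential_iff[OF assms(1-3)])
qed

section \<open>Effective resistance: value, Dirichlet bound, monotonicity\<close>

text \<open>Pairing two potentials with each other shows that both drops equal their mutual energy,
  which is symmetric; hence the definite description denotes.\<close>

lemma eff_res_eq:
  fixes c :: "'a::finite set \<Rightarrow> real"
  assumes "\<Union>A \<subseteq> V" "x \<in> V" "y \<in> V" "(x, y) \<in> (edge_adj {e \<in> A. 0 < c e})\<^sup>*"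
    and "unit_current_potential V A c x y v"
  shows "eff_res V A c x y = ereal (v x - v y)"
proof -
  have unique: "v' x - v' y = v x - v y" if "unit_current_potential V A c x y v'" for v'
    using energy_potential[OF assms(1-3) that, of v] energy_potential[OF assms(1-3,5), of v']
      energy_commute[of A c v v'] by linarith
  have "(THE r. \<exists>v. unit_current_potential V A c x y v \<and> r = v x - v y) = v x - v y"
  proof (rule the_equality)
    show "\<exists>v'. unit_current_potential V A c x y v' \<and> v x - v y = v' x - v' y"
      using assms(5) by (intro exI[of _ v] conjI refl)
  next
    fix r assume "\<exists>v'. unit_current_potential V A c x y v' \<and> r = v' x - v' y"
    then obtain v' where "unit_current_potential V A c x y v'" "r = v' x - v' y"
      by (elim exE conjE)
    then show "r = v x - v y"
      using unique by (elim ssubst)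
  qed
  then show ?thesis
    by (simp add: eff_res_def assms(4))
qed

text \<open>Dirichlet's principle: Cauchy-Schwarz for \<open>f\<close> and the potential
  \<open>v\<close>, where the mixed energy is \<open>f x - f y\<close> and the energy of
  \<open>v\<close> is the resistance.\<close>

lemma eff_res_finite:
  fixes c :: "'a::finite set \<Rightarrow> real"
  assumes "\<Union>A \<subseteq> V" "x \<in> V" "y \<in> V" "\<And>e. e \<in> A \<Longrightarrow> 0 \<le> c e"
    and "(x, y) \<in> (edge_adj {e \<in> A. 0 < c e})\<^sup>*"
  obtains v where "eff_res V A c x y = ereal (v x - v y)" "energy A c v v = v x - v y"
    "\<And>f. (f x - f y)\<^sup>2 \<le> (v x - v y) * energy A c f f"
proof -
  obtain v where v: "unit_current_potential V A c x y v"
    by (rule unit_current_potential_exists[OF assms])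
  note E = energy_potential[OF assms(1-3) v]
  have "(f x - f y)\<^sup>2 \<le> (v x - v y) * energy A c f f" for f
    using energy_Cauchy_Schwarz[of A c f v] assms(4) unfolding E by (simp only: mult.commute)
  then show thesis
    by (rule that[OF eff_res_eq[OF assms(1-3,5) v] E])
qed

text \<open>Rayleigh monotonicity, for raising conductances and deleting vertices or edges at once:
  the potential of the larger network is a trial function in the Dirichlet bound of the smaller one.
  If the smaller network does not join \<open>x\<close> to \<open>y\<close>, the right side is
  infinite.\<close>

lemma eff_res_mono:
  fixes c c' :: "'a::finite set \<Rightarrow> real"
  assumes "\<Union>A \<subseteq> V" "\<Union>A' \<subseteq> V'" "V' \<subseteq> V" "A' \<subseteq> A" "x \<in> V'" "y \<in> V'"
    and c: "\<And>e. e \<in> A' \<Longrightarrow> 0 \<le> c e \<and> c e \<le> c' e" and c': "\<And>e. e \<in> A \<Longrightarrow> 0 \<le> c' e"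
  shows "eff_res V A c' x y \<le> eff_res V' A' c x y"
proof (cases "(x, y) \<in> (edge_adj {e \<in> A'. 0 < c e})\<^sup>*")
  case True
  have "edge_adj {e \<in> A'. 0 < c e} \<subseteq> edge_adj {e \<in> A. 0 < c' e}"
    using assms(4) c by (force simp: edge_adj_def)
  then have True': "(x, y) \<in> (edge_adj {e \<in> A. 0 < c' e})\<^sup>*"
    using True rtrancl_mono by blast
  obtain v where v: "eff_res V' A' c x y = ereal (v x - v y)" "energy A' c v v = v x - v y"
    "\<And>f. (f x - f y)\<^sup>2 \<le> (v x - v y) * energy A' c f f"
    by (rule eff_res_finite[OF assms(2,5,6) _ True]) (use c in auto)
  obtain v' where v': "eff_res V A c' x y = ereal (v' x - v' y)" "energy A c' v' v' = v' x - v' y"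
    by (rule eff_res_finite[OF assms(1) _ _ c' True']) (use assms(3,5,6) in auto)
  let ?r = "v x - v y" and ?r' = "v' x - v' y"
  have r: "0 \<le> ?r"
    using energy_nonneg[of A' c v] c v(2) by simp
  have "?r'\<^sup>2 \<le> ?r * energy A' c v' v'"
    by (rule v(3))
  also have "\<dots> \<le> ?r * energy A c' v' v'"
    using energy_mono[of A' A c' c v'] assms(4) c' c r by (simp add: mult_left_mono)
  finally have "?r' * ?r' \<le> ?r * ?r'"
    by (simp add: v'(2) power2_eq_square)
  \<comment> \<open>A positive \<open>?r'\<close> cancels; otherwise
    \<open>?r' \<le> 0 \<le> ?r\<close>.\<close>
  then have "?r' \<le> ?r"
    using r by (simp add: mult_le_cancel_right split: if_splits) linarith
  then show ?thesis
    by (simp add: v(1) v'(1))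
qed (simp add: eff_res_def)

text \<open>Each two-element edge comes from exactly two ordered pairs, which cancels the factor
  1/2. The function \<open>g\<close> is left free so that a term written through an orientation
  fits.\<close>

lemma energy_sum_edges:
  fixes f :: "'a::finite \<Rightarrow> real"
  assumes A: "\<And>e. e \<in> A \<Longrightarrow> card e = 2"
    and g: "\<And>i j. {i, j} \<in> A \<Longrightarrow> g {i, j} = c {i, j} * (f i - f j)\<^sup>2"
  shows "energy A c f f = sum g A"
proof -
  let ?S = "{p. {fst p, snd p} \<in> A}"
  let ?E = "\<lambda>p. {fst p, snd p}"
  have "2 * energy A c f f = (\<Sum>p\<in>UNIV. edge_weight A c (fst p) (snd p) * (f (fst p) - f (snd p))\<^sup>2)"
    by (simp add: energy_def sum.cartesian_product case_prod_beta power2_eq_square)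
  also have "\<dots> = (\<Sum>p\<in>?S. g (?E p))"
    by (rule sum.mono_neutral_cong_right) (auto simp: edge_weight_def g)
  also have "\<dots> = (\<Sum>e\<in>A. \<Sum>p\<in>{p. p \<in> ?S \<and> ?E p = e}. g (?E p))"
    by (rule sum.group[symmetric]) auto
  also have "\<dots> = (\<Sum>e\<in>A. 2 * g e)"
  proof (rule sum.cong[OF refl])
    fix e assume e: "e \<in> A"
    obtain i j where ij: "e = {i, j}" "i \<noteq> j"
      using A[OF e] by (auto simp: card_2_iff)
    have "{p. p \<in> ?S \<and> ?E p = e} = {(i, j), (j, i)}"
      using e ij by (auto simp: doubleton_eq_iff insert_commute)
    then show "(\<Sum>p\<in>{p. p \<in> ?S \<and> ?E p = e}. g (?E p)) = 2 * g e"
      using ij by (simp add: insert_commute)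
  qed
  finally show ?thesis
    by (simp add: sum_distrib_left[symmetric])
qed

section \<open>Rank-one perturbations of positive definite matrices\<close>

lemma matrix_sub_ldistrib: "(A::real^'n^'m) ** (C - D) = A ** C - A ** D"
  by (simp add: matrix_matrix_mult_def vec_eq_iff sum_subtractf algebra_simps)

lemma matrix_sub_rdistrib: "((A::real^'n^'m) - C) ** D = A ** D - C ** D"
  by (simp add: matrix_matrix_mult_def vec_eq_iff sum_subtractf algebra_simps)

lemma diag_mult_vector: "diag f *v x = (\<chi> i. f i * x $ i)"
  by (simp add: diag_def matrix_vector_mult_def vec_eq_iff if_distrib if_distribR cong: if_cong)

lemma diag_mult_matrix: "diag f ** A = (\<chi> i j. f i * A $ i $ j)"
  by (simp add: diag_def matrix_matrix_mult_def vec_eq_iff if_distrib if_distribR cong: if_cong)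

lemma diag_mult_diag: "diag f ** diag g = diag (\<lambda>i. f i * g i)"
  by (simp add: diag_mult_matrix) (simp add: diag_def vec_eq_iff)

lemma transpose_diag [simp]: "transpose (diag f) = diag f"
  by (auto simp: diag_def transpose_def vec_eq_iff)

lemma transpose_mult_vector_nth: "(transpose P *v v) $ e = column e P \<bullet> v"
  by (simp add: transpose_def column_def matrix_vector_mult_def inner_vec_def)

lemma inner_congruence:
  fixes P :: "real^'e^'v"
  shows "v \<bullet> ((P ** M ** transpose P) *v w) = (transpose P *v v) \<bullet> (M *v (transpose P *v w))"
  by (simp add: matrix_vector_mul_assoc[symmetric] dot_lmul_matrix[symmetric] vector_transpose_matrix)

text \<open>Such a matrix is a weighted sum of rank-one matrices built from the columns of
  \<open>P\<close>. Both \<open>D_mat\<close> and the perturbation subtracted from it have this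
  shape.\<close>

lemma inner_congruence_diag:
  fixes P :: "real^'e^'v"
  shows "v \<bullet> ((P ** diag w ** transpose P) *v v) = (\<Sum>e\<in>UNIV. w e * (column e P \<bullet> v)\<^sup>2)"
  unfolding inner_congruence
  by (simp add: inner_vec_def diag_mult_vector transpose_mult_vector_nth power2_eq_square algebra_simps
      del: transpose_matrix_vector)

lemma transpose_congruence_diag:
  "transpose (P ** diag w ** transpose P) = P ** diag w ** transpose P"
  by (simp add: matrix_transpose_mul matrix_mul_assoc)

text \<open>Positive definiteness leaves only the trivial kernel. As \<open>matrix_inv\<close> is
  defined by choice, a two-sided inverse is exhibited first.\<close>

lemma matrix_inv_pos_definite:
  assumes "pos_definite A"
  shows "A ** matrix_inv A = mat 1" "matrix_inv A ** A = mat 1"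
proof -
  have "\<forall>x. A *v x = 0 \<longrightarrow> x = 0"
    using assms by (metis inner_zero_right less_irrefl pos_definite_def)
  then obtain C where "C ** A = mat 1"
    using matrix_left_invertible_ker by blast
  then have "\<exists>C. A ** C = mat 1 \<and> C ** A = mat 1"
    using matrix_left_right_inverse by blast
  then show "A ** matrix_inv A = mat 1" "matrix_inv A ** A = mat 1"
    unfolding matrix_inv_def by (metis (mono_tags, lifting) someI_ex)+
qed

section \<open>Determinants under a change of one diagonal entry\<close>

lemma det_one_minus_row:
  fixes H :: "real^'e^'e"
  shows "det (mat 1 - diag (\<lambda>e. if e = k then a else 0) ** H) = 1 - a * H $ k $ k"
proof -
  \<comment> \<open>The matrix differs from the identity only in row \<open>k\<close>, which is
    \<open>x\<close>; transposed, it is the identity with column \<open>k\<close> replaced, as in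
    Cramer's rule.\<close>
  define x :: "real^'e" where "x = (\<chi> j. (if j = k then 1 else 0) - a * H $ k $ j)"
  have "transpose (mat 1 - diag (\<lambda>e. if e = k then a else 0) ** H)
      = (\<chi> i j. if j = k then (mat 1 *v x) $ i else (mat 1 :: real^'e^'e) $ i $ j)"
    unfolding matrix_vector_mul_lid by (auto simp: x_def transpose_def diag_mult_matrix mat_def vec_eq_iff)
  then show ?thesis
    using cramer_lemma[of k "mat 1" x] det_transpose[of "mat 1 - diag (\<lambda>e. if e = k then a else 0) ** H"]
    by (simp add: x_def)
qed

text \<open>A form of the matrix determinant lemma. Moving \<open>P\<close> past \<open>A\<close>
  gives \<open>D - P ** diag w ** transpose P\<close> times \<open>Di ** P\<close>; applying
  \<open>Ni\<close> yields \<open>H ** A = G\<close>. The change \<open>E\<close> then splits off as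
  the left factor \<open>mat 1 - E ** H\<close>, which alters a single row of the identity.\<close>

lemma det_one_minus_diag_update:
  fixes D :: "real^'v^'v" and P :: "real^'e^'v"
  assumes D: "D ** Di = mat 1" and N: "Ni ** (D - P ** diag w ** transpose P) = mat 1"
  shows "det (mat 1 - diag (\<lambda>e. w e + (if e = k then a else 0)) ** (transpose P ** Di ** P))
    = (1 - a * (transpose P ** Ni ** P) $ k $ k) * det (mat 1 - diag w ** (transpose P ** Di ** P))"
proof -
  define G where "G = transpose P ** Di ** P"
  define H where "H = transpose P ** Ni ** P"
  define A where "A = mat 1 - diag w ** G"
  define E where "E = diag (\<lambda>e. if e = k then a else 0)"
  have "P ** A = P - P ** diag w ** transpose P ** Di ** P"
    by (simp add: A_def G_def matrix_sub_ldistrib matrix_mul_assoc)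
  also have "\<dots> = (D - P ** diag w ** transpose P) ** (Di ** P)"
    by (simp add: matrix_sub_rdistrib matrix_mul_assoc D)
  finally have "H ** A = transpose P ** (Ni ** (D - P ** diag w ** transpose P)) ** (Di ** P)"
    by (simp add: H_def matrix_mul_assoc[symmetric])
  then have HA: "H ** A = G"
    by (simp add: N G_def matrix_mul_assoc)
  have "diag (\<lambda>e. w e + (if e = k then a else 0)) ** G = diag w ** G + E ** G"
    by (simp add: E_def diag_mult_matrix vec_eq_iff distrib_right)
  then have "mat 1 - diag (\<lambda>e. w e + (if e = k then a else 0)) ** G = A - E ** G"
    by (simp add: A_def)
  also have "\<dots> = (mat 1 - E ** H) ** A"
    by (simp add: matrix_sub_rdistrib HA matrix_mul_assoc[symmetric])
  finally show ?thesis
    unfolding G_def[symmetric] H_def[symmetric]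
    by (simp add: det_mul E_def det_one_minus_row A_def[symmetric])
qed

lemma congruence_entry: "(transpose P ** N ** P) $ k $ k = column k P \<bullet> (N *v column k P)"
  for P :: "real^'e^'v"
proof -
  have "(transpose P ** N ** P) $ k $ k = axis k 1 \<bullet> ((transpose P ** N ** P) *v axis k 1)"
    by (simp add: inner_axis' matrix_vector_mult_basis column_def)
  also have "\<dots> = column k P \<bullet> (N *v column k P)"
    using inner_congruence[of "axis k 1" "transpose P" N "axis k 1"]
    by (simp add: matrix_vector_mult_basis)
  finally show ?thesis .
qed

section \<open>Perturbations controlled by energies with bounded sum\<close>

text \<open>Here \<open>\<E> e\<close> stands for the energy of the subnetwork assigned to
  \<open>e\<close> and \<open>r e\<close> for its resistance. Each subtracted square costs at most
  its own energy, and together these energies fit into \<open>D\<close>.\<close>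

lemma pos_definite_diff:
  fixes D :: "real^'v^'v" and P :: "real^'e^'v" and \<E> :: "'e \<Rightarrow> real^'v \<Rightarrow> real"
  assumes D: "pos_definite D"
    and \<E>_nonneg: "\<And>e v. e \<in> T \<Longrightarrow> 0 \<le> \<E> e v"
    and \<E>_sum: "\<And>v. (\<Sum>e\<in>T. \<E> e v) \<le> v \<bullet> (D *v v)"
    and bound: "\<And>e v. e \<in> T \<Longrightarrow> (column e P \<bullet> v)\<^sup>2 \<le> r e * \<E> e v"
    and w: "\<And>e. e \<in> T \<Longrightarrow> 0 \<le> w e \<and> w e * r e < 1"
  shows "pos_definite (D - P ** diag (\<lambda>e. if e \<in> T then w e else 0) ** transpose P)"
    (is "pos_definite ?N")
  unfolding pos_definite_def
proof (intro conjI allI impI)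
  show "transpose ?N = ?N"
    using D transpose_congruence_diag[of P]
    by (simp add: pos_definite_def transpose_def vec_eq_iff)
  fix v :: "real^'v" assume "v \<noteq> 0"
  then have Dv: "0 < v \<bullet> (D *v v)"
    using D by (simp add: pos_definite_def)
  have "v \<bullet> (?N *v v) = v \<bullet> (D *v v) - (\<Sum>e\<in>T. w e * (column e P \<bullet> v)\<^sup>2)"
    by (simp add: matrix_vector_mult_diff_rdistrib inner_diff_right inner_congruence_diag
        if_distribR if_distrib sum.If_cases cong: if_cong)
  moreover have "(\<Sum>e\<in>T. w e * (column e P \<bullet> v)\<^sup>2) < v \<bullet> (D *v v)"
  \<comment> \<open>Strictness has two sources: if all energies vanish at \<open>v\<close>, so do
    the subtracted squares and \<open>D\<close> itself is positive; otherwise some energy is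
    positive and \<open>w k * r k < 1\<close> leaves a gap.\<close>
  proof (cases "\<forall>e\<in>T. \<E> e v = 0")
    case True
    have "(\<Sum>e\<in>T. w e * (column e P \<bullet> v)\<^sup>2) = 0"
      by (rule sum.neutral) (use bound[of _ v] True in auto)
    then show ?thesis
      using Dv by simp
  next
    case False
    then obtain k where k: "k \<in> T" "0 < \<E> k v"
      using \<E>_nonneg by (metis order_le_less)
    have le: "w e * (column e P \<bullet> v)\<^sup>2 \<le> (w e * r e) * \<E> e v" if "e \<in> T" for e
      using mult_left_mono[OF bound[OF that, of v]] w[OF that] by (simp add: mult.assoc)
    have "(\<Sum>e\<in>T. w e * (column e P \<bullet> v)\<^sup>2) < (\<Sum>e\<in>T. \<E> e v)"
    proof (rule sum_strict_mono_ex1)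
      show "\<forall>e\<in>T. w e * (column e P \<bullet> v)\<^sup>2 \<le> \<E> e v"
      proof
        fix e assume e: "e \<in> T"
        have "(w e * r e) * \<E> e v \<le> 1 * \<E> e v"
          by (rule mult_right_mono) (use w[OF e] \<E>_nonneg[OF e] in auto)
        then show "w e * (column e P \<bullet> v)\<^sup>2 \<le> \<E> e v"
          using le[OF e] by simp
      qed
      have "(w k * r k) * \<E> k v < 1 * \<E> k v"
        by (rule mult_strict_right_mono) (use w[OF k(1)] k in auto)
      then show "\<exists>e\<in>T. w e * (column e P \<bullet> v)\<^sup>2 < \<E> e v"
        using le[OF k(1)] k(1) by force
    qed simp
    then show ?thesis
      using \<E>_sum[of v] by simp
  qed
  ultimately show "0 < v \<bullet> (?N *v v)"
    by simp
qed

text \<open>Induction over the perturbed edges, one determinant factor per edge. The energy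
  hypothesis sums over \<open>T\<close> only and passes to smaller sets because \<open>\<E>\<close>
  is nonnegative.\<close>

lemma det_lower_bound:
  fixes D :: "real^'v^'v" and P :: "real^'e^'v" and \<E> :: "'e \<Rightarrow> real^'v \<Rightarrow> real"
  assumes D: "pos_definite D"
    and \<E>_nonneg: "\<And>e v. e \<in> T \<Longrightarrow> 0 \<le> \<E> e v"
    and \<E>_sum: "\<And>v. (\<Sum>e\<in>T. \<E> e v) \<le> v \<bullet> (D *v v)"
    and bound: "\<And>e v. e \<in> T \<Longrightarrow> (column e P \<bullet> v)\<^sup>2 \<le> r e * \<E> e v"
    and r: "\<And>e. e \<in> T \<Longrightarrow> 0 \<le> r e"
    and w: "\<And>e. e \<in> T \<Longrightarrow> 0 \<le> w e \<and> w e * r e < 1"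
  shows "(\<Prod>e\<in>T. 1 - w e * r e)
    \<le> det (mat 1 - diag (\<lambda>e. if e \<in> T then w e else 0) ** (transpose P ** matrix_inv D ** P))"
  using finite[of T] \<E>_nonneg \<E>_sum bound r w
proof (induction T rule: finite_induct)
  case empty
  then show ?case
    by (simp add: diag_mult_matrix zero_vec_def[symmetric])
next
  case (insert k T)
  define f where "f = (\<lambda>e. if e \<in> T then w e else 0)"
  define N where "N = D - P ** diag f ** transpose P"
  have sum_T: "(\<Sum>e\<in>T. \<E> e v) \<le> v \<bullet> (D *v v)" for v
    using insert.prems(2)[of v] insert.prems(1)[of k v] insert.hyps by simp
  have N: "pos_definite N"
    unfolding N_def f_def
    by (rule pos_definite_diff[OF D _ sum_T, where r = r]) (use insert.prems in auto)
  let ?x = "column k P"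
  \<comment> \<open>The factor contributed by \<open>k\<close> is
    \<open>1 - w k * (?x \<bullet> z)\<close>. The vector \<open>z\<close> is the response of
    \<open>N\<close> to the source \<open>?x\<close>, so \<open>?x \<bullet> z\<close> is its energy
    under \<open>N\<close>.\<close>
  define z where "z = matrix_inv N *v ?x"
  have Nz: "N *v z = ?x"
    by (simp add: z_def matrix_vector_mul_assoc matrix_inv_pos_definite[OF N])
  have beta: "?x \<bullet> z = z \<bullet> (N *v z)"
    by (simp add: Nz inner_commute)
  \<comment> \<open>Edges of \<open>T\<close> use up at most their own energies, so the share of
    \<open>k\<close> in \<open>D\<close> survives in \<open>N\<close>.\<close>
  have "\<E> k z \<le> z \<bullet> (N *v z)"
  proof -
    have "(\<Sum>e\<in>T. w e * (column e P \<bullet> z)\<^sup>2) \<le> (\<Sum>e\<in>T. \<E> e z)"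
    proof (rule sum_mono)
      fix e assume e: "e \<in> T"
      have "w e * (column e P \<bullet> z)\<^sup>2 \<le> w e * (r e * \<E> e z)"
        by (rule mult_left_mono) (use insert.prems e in auto)
      also have "\<dots> = (w e * r e) * \<E> e z"
        by simp
      also have "\<dots> \<le> 1 * \<E> e z"
        by (rule mult_right_mono) (use insert.prems(1,5) e in \<open>auto intro: less_imp_le\<close>)
      finally show "w e * (column e P \<bullet> z)\<^sup>2 \<le> \<E> e z"
        by simp
    qed
    moreover have "z \<bullet> (N *v z) = z \<bullet> (D *v z) - (\<Sum>e\<in>T. w e * (column e P \<bullet> z)\<^sup>2)"
      by (simp add: N_def f_def matrix_vector_mult_diff_rdistrib inner_diff_right inner_congruence_diag
          if_distribR if_distrib sum.If_cases cong: if_cong)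
    moreover have "\<E> k z + (\<Sum>e\<in>T. \<E> e z) \<le> z \<bullet> (D *v z)"
      using insert.prems(2)[of z] insert.hyps by simp
    ultimately show ?thesis
      by linarith
  qed
  then have "r k * \<E> k z \<le> r k * (?x \<bullet> z)"
    unfolding beta by (rule mult_left_mono) (use insert.prems(4) in simp)
  \<comment> \<open>The bound at the test vector \<open>z\<close> gives a quadratic inequality for
    \<open>?x \<bullet> z\<close>; cancelling one factor yields
    \<open>?x \<bullet> z \<le> r k\<close>, as Dirichlet's principle does for resistances.\<close>
  then have "(?x \<bullet> z) * (?x \<bullet> z) \<le> r k * (?x \<bullet> z)"
    using insert.prems(3)[of k z] by (simp add: power2_eq_square)
  moreover have "0 \<le> ?x \<bullet> z"
    using N unfolding beta pos_definite_def by (cases "z = 0") (simp_all add: less_imp_le)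
  ultimately have xz: "?x \<bullet> z \<le> r k"
    using insert.prems(4)[of k] by (cases "?x \<bullet> z = 0") auto
  have f_insert: "(\<lambda>e. if e \<in> insert k T then w e else 0) = (\<lambda>e. f e + (if e = k then w k else 0))"
    using insert.hyps by (auto simp: f_def)
  have "(\<Prod>e\<in>insert k T. 1 - w e * r e) = (1 - w k * r k) * (\<Prod>e\<in>T. 1 - w e * r e)"
    using insert.hyps by simp
  also have "\<dots> \<le> (1 - w k * (?x \<bullet> z)) * det (mat 1 - diag f ** (transpose P ** matrix_inv D ** P))"
  proof (rule mult_mono)
    have wk: "0 \<le> w k" "w k * r k < 1"
      using insert.prems(5)[of k] by auto
    then show "1 - w k * r k \<le> 1 - w k * (?x \<bullet> z)"
      using mult_left_mono[OF xz wk(1)] by simp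
    then show "0 \<le> 1 - w k * (?x \<bullet> z)"
      using wk by simp
    show "(\<Prod>e\<in>T. 1 - w e * r e) \<le> det (mat 1 - diag f ** (transpose P ** matrix_inv D ** P))"
      unfolding f_def by (rule insert.IH) (use insert.prems sum_T in auto)
    show "0 \<le> (\<Prod>e\<in>T. 1 - w e * r e)"
      by (rule prod_nonneg) (use insert.prems(5) in \<open>auto intro: less_imp_le\<close>)
  qed
  also have "\<dots> = det (mat 1 - diag (\<lambda>e. f e + (if e = k then w k else 0))
      ** (transpose P ** matrix_inv D ** P))"
    using det_one_minus_diag_update[OF matrix_inv_pos_definite(1)[OF D]
        matrix_inv_pos_definite(2)[OF N[unfolded N_def]], of k "w k"]
    by (simp add: congruence_entry z_def N_def)
  finally show ?case
    unfolding f_insert .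
qed

section \<open>The weighted complete graph\<close>

text \<open>Two negative factors would have a positive product and spoil the comparison. With
  \<open>K\<close> empty, nonnegative factors are compared one by one; with a single exceptional
  factor the left product is at most 0. Values of \<open>f\<close> may be infinite.\<close>

lemma prod_ereal_le:
  fixes f :: "'i \<Rightarrow> ereal" and g :: "'i \<Rightarrow> real"
  assumes "finite I" "K \<subseteq> I" "card K \<le> 1"
    and f: "\<And>i. i \<in> I - K \<Longrightarrow> 0 \<le> f i" "\<And>i. i \<in> I - K \<Longrightarrow> f i \<le> ereal (g i)"
    and K: "\<And>i. i \<in> K \<Longrightarrow> f i \<le> 0" and g: "\<And>i. i \<in> I \<Longrightarrow> 0 \<le> g i"
  shows "prod f I \<le> ereal (prod g I)"
proof (cases "K = {}")
  case True
  show ?thesis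
    using \<open>finite I\<close> f(1)[unfolded True] f(2)[unfolded True]
  proof (induction I rule: finite_induct)
    case (insert i I)
    have "f i * prod f I \<le> ereal (g i) * ereal (prod g I)"
      by (rule ereal_mult_mono') (use insert in \<open>auto intro: prod_ereal_pos\<close>)
    then show ?case
      using insert.hyps by simp
  qed simp
next
  case False
  then have "0 < card K"
    using finite_subset[OF assms(2,1)] by (simp add: card_gt_0_iff)
  then have "card K = 1"
    using assms(3) by linarith
  then obtain k where k: "K = {k}"
    by (auto simp: card_1_singleton_iff)
  have "prod f I = f k * prod f (I - {k})"
    using assms(1,2) k by (simp add: prod.remove)
  also have "\<dots> \<le> 0"
    using K f(1) k by (auto simp: ereal_mult_le_0_iff intro!: prod_ereal_pos)
  also have "0 \<le> ereal (prod g I)"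
    using g by (simp add: prod_nonneg)
  finally show ?thesis .
qed

lemma one_minus_ereal_le_0: "1 - z \<le> 0" if "1 < z" for z :: ereal
  using that by (cases z) (auto simp: one_ereal_def)

section \<open>The quadratic form of \<open>D_mat\<close>\<close>

lemma B_pos: "0 < B u s i j"
proof -
  have "1 \<le> cosh (ext u i - ext u j)"
    by (rule cosh_real_ge_1)
  moreover have "0 \<le> 1 / 2 * (ext s i - ext s j)\<^sup>2 * exp (ext u i + ext u j)"
    by simp
  ultimately show ?thesis
    unfolding B_def by linarith
qed

lemma B_commute: "B u s i j = B u s j i"
proof -
  have "cosh (ext u i - ext u j) = cosh (ext u j - ext u i)"
    using cosh_minus[of "ext u i - ext u j"] by simp
  then show ?thesis
    by (simp add: B_def power2_commute[of "ext s i"] add.commute)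
qed

lemma ends_edges: "ends e \<in> all_edges"
  by (rule ends)

lemma range_ends: "range ends = all_edges"
  by (rule type_definition.Rep_range[OF type_definition_edge])

lemma orientation_ends:
  assumes "orientation h t" "{i, j} \<in> all_edges"
  shows "h {i, j} = i \<and> t {i, j} = j \<or> h {i, j} = j \<and> t {i, j} = i"
proof -
  have "{i, j} = {h {i, j}, t {i, j}}"
    using assms by (simp add: orientation_def)
  then show ?thesis
    unfolding doubleton_eq_iff by auto
qed

lemma all_edges_neq: "{i, j} \<in> all_edges \<Longrightarrow> i \<noteq> j"
  by (auto simp: all_edges_def)

text \<open>The incidence matrix has no row for \<rho>; this matches the value 0 that
  \<open>ext\<close> takes at \<open>None\<close>, so the transpose is the full discrete
  gradient.\<close>

lemma column_F_mat: "column e (F_mat h t) \<bullet> v = ext v (h (ends e)) - ext v (t (ends e))"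
proof -
  have *: "(\<Sum>k\<in>UNIV. (if z = Some k then 1 else 0) * v $ k) = ext v z" for z
    by (cases z) (simp_all add: ext_def if_distribR if_distrib cong: if_cong)
  show ?thesis
    by (simp add: column_def F_mat_def inner_vec_def left_diff_distrib sum_subtractf *)
qed

lemma D_mat_inner:
  "v \<bullet> (D_mat h t W u *v v) = (\<Sum>e\<in>all_edges. W e * exp (ext u (h e) + ext u (t e))
      * (ext v (h e) - ext v (t e))\<^sup>2)"
  unfolding range_ends[symmetric]
  by (simp add: D_mat_def W_mat_def inner_congruence_diag column_F_mat sum.reindex inj_on_def ends_inject)

text \<open>If the form vanishes at \<open>v\<close>, the extension of \<open>v\<close> is constant
  on the connected graph of positive weights, and its value at \<rho> is 0.\<close>

lemma D_mat_pos_definite: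
  fixes W :: "'v::finite option set \<Rightarrow> real"
  assumes W: "\<And>e. e \<in> all_edges \<Longrightarrow> 0 \<le> W e" and conn: "graph_connected UNIV (pos_edges W)"
    and orient: "orientation h t"
  shows "pos_definite (D_mat h t W u)"
  unfolding pos_definite_def
proof (intro conjI allI impI)
  show "transpose (D_mat h t W u) = D_mat h t W u"
    unfolding D_mat_def W_mat_def by (rule transpose_congruence_diag)
  fix v :: "real^'v" assume "v \<noteq> 0"
  let ?g = "\<lambda>e. W e * exp (ext u (h e) + ext u (t e)) * (ext v (h e) - ext v (t e))\<^sup>2"
  have g: "0 \<le> ?g e" if "e \<in> all_edges" for e
    using W[OF that] by simp
  have "v \<bullet> (D_mat h t W u *v v) \<noteq> 0"
  proof
    assume "v \<bullet> (D_mat h t W u *v v) = 0"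
    then have "\<forall>e\<in>all_edges. ?g e = 0"
      unfolding D_mat_inner using sum_nonneg_eq_0_iff[of all_edges ?g] g by simp
    then have "ext v i = ext v j" if "{i, j} \<in> pos_edges W" for i j
      using that orientation_ends[OF orient, of i j] by (auto simp: pos_edges_def dest!: bspec[of _ _ "{i, j}"])
    then have "ext v (Some k) = ext v None" for k
      by (rule edge_adj_const) (use conn in \<open>auto simp: graph_connected_def\<close>)
    then have "v = 0"
      by (simp add: ext_def vec_eq_iff)
    with \<open>v \<noteq> 0\<close> show False by simp
  qed
  moreover have "0 \<le> v \<bullet> (D_mat h t W u *v v)"
    unfolding D_mat_inner by (rule sum_nonneg) (rule g)
  ultimately show "0 < v \<bullet> (D_mat h t W u *v v)"
    by simp
qed

section \<open>The determinant bound with real resistances\<close>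

text \<open>At a fixed \<open>(u, s)\<close> the resistances are finite because each
  \<open>Es l\<close> is connected with positive weights. Naming them as reals keeps the determinant
  argument free of infinite values.\<close>

lemma det_ge_prod_resistances:
  fixes W m :: "'v::finite option set \<Rightarrow> real"
    and h t :: "'v option set \<Rightarrow> 'v option"
    and x y :: "nat \<Rightarrow> 'v option"
    and Es :: "nat \<Rightarrow> 'v option set set"
  assumes W_nonneg: "\<And>e. e \<in> all_edges \<Longrightarrow> 0 \<le> W e"
    and G_plus_connected: "graph_connected UNIV (pos_edges W)"
    and m_nonneg: "\<And>e. e \<in> all_edges \<Longrightarrow> 0 \<le> m e"
    and orient: "orientation h t"
    and enum: "bij_betw (\<lambda>l. {x l, y l}) {1..n} {e \<in> all_edges. 0 < m e}"
    and disj: "disjoint_family_on Es {1..n}"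
    and Es_subset: "\<And>l. l \<in> {1..n} \<Longrightarrow> Es l \<subseteq> pos_edges W"
    and Es_connected: "\<And>l. l \<in> {1..n} \<Longrightarrow> graph_connected (\<Union>(Es l)) (Es l)"
    and Es_ends: "\<And>l. l \<in> {1..n} \<Longrightarrow> x l \<in> \<Union>(Es l) \<and> y l \<in> \<Union>(Es l)"
    and res_bound: "\<And>l. l \<in> {1..n} \<Longrightarrow>
        ereal (m {x l, y l}) * res_G (Es l) (conductance W u s (x l) (y l)) (x l) (y l) < 1"
  obtains r where
    "\<And>l. l \<in> {1..n} \<Longrightarrow> res_G (Es l) (conductance W u s (x l) (y l)) (x l) (y l) = ereal (r l)"
    "\<And>l. l \<in> {1..n} \<Longrightarrow> m {x l, y l} * r l < 1"
    "pos_definite (D_mat h t W u - F_mat h t ** M_mat m ** Q_mat h t u s ** transpose (F_mat h t))"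
    "(\<Prod>l=1..n. 1 - m {x l, y l} * r l) \<le> det (mat 1 - M_mat m ** G_mat h t W u s)"
proof -
  \<comment> \<open>The network conductances are \<open>a\<close> divided by \<open>q l\<close>,
    where \<open>a\<close> does not depend on \<open>l\<close> and \<open>q l\<close> is the entry
    of \<open>Q_mat\<close> at the \<open>l\<close>-th edge.\<close>
  define a where "a = (\<lambda>e. W e * exp (\<Sum>k\<in>e. ext u k))"
  define q where "q = (\<lambda>l. exp (ext u (x l) + ext u (y l)) / B u s (x l) (y l))"
  define ed where "ed = (\<lambda>l. Edge {x l, y l} :: 'v edge)"
  define T where "T = {e :: 'v edge. 0 < m (ends e)}"
  define ix where "ix = inv_into {1..n} ed"
  \<comment> \<open>Absorbing the root of \<open>Q_mat\<close> into the columns makes one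
    \<open>P\<close> serve both claims: \<open>P ** M_mat m ** transpose P\<close> is the subtracted
    matrix, and \<open>G_mat\<close> is the congruence of the inverse of \<open>D_mat\<close> by
    \<open>P\<close>.\<close>
  define P where "P = F_mat h t ** sqrtQ_mat h t u s"
  have xy: "{x l, y l} \<in> all_edges" "0 < m {x l, y l}" if "l \<in> {1..n}" for l
    using bij_betwE[OF enum] that by auto
  have ends_ed: "ends (ed l) = {x l, y l}" if "l \<in> {1..n}" for l
    using xy[OF that] by (simp add: ed_def Edge_inverse)
  have ed_bij: "bij_betw ed {1..n} T"
  proof (rule bij_betw_imageI)
    show "inj_on ed {1..n}"
    proof (rule inj_onI)
      fix l k assume lk: "l \<in> {1..n}" "k \<in> {1..n}" and "ed l = ed k"
      then have "{x l, y l} = {x k, y k}"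
        using ends_ed by (simp flip: ends_ed)
      then show "l = k"
        using bij_betw_imp_inj_on[OF enum] lk by (simp add: inj_onD)
    qed
    have "e \<in> ed ` {1..n}" if "e \<in> T" for e
    proof -
      have "ends e \<in> (\<lambda>l. {x l, y l}) ` {1..n}"
        using that ends_edges[of e] bij_betw_imp_surj_on[OF enum] by (simp add: T_def)
      then show ?thesis
        using ends_inverse[of e] by (auto simp: ed_def)
    qed
    then show "ed ` {1..n} = T"
      using ends_ed xy by (auto simp: T_def)
  qed
  then have ix: "ix (ed l) = l" if "l \<in> {1..n}" for l
    unfolding ix_def using that by (simp add: bij_betw_imp_inj_on)
  have T_cases: "\<exists>l\<in>{1..n}. e = ed l" if "e \<in> T" for e
    using that bij_betw_imp_surj_on[OF ed_bij] by auto
  have q_pos: "0 < q l" for l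
    by (simp add: q_def B_pos)
  have Q_ed: "Q_entry h t u s (ed l) = q l" if "l \<in> {1..n}" for l
    using orientation_ends[OF orient xy(1)[OF that]]
    by (auto simp: Q_entry_def ends_ed[OF that] q_def add.commute B_commute)
  have Es_all: "Es l \<subseteq> all_edges" if "l \<in> {1..n}" for l
    using Es_subset[OF that] by (auto simp: pos_edges_def)
  have a_pos: "0 < a e" if "l \<in> {1..n}" "e \<in> Es l" for l e
    using Es_subset[OF that(1)] that(2) by (auto simp: pos_edges_def a_def)
  have cond: "conductance W u s (x l) (y l) e = (1 / q l) * a e" for l e
    by (simp add: conductance_def a_def q_def)

  \<comment> \<open>Rescaling by \<open>q l\<close> rewrites every Dirichlet bound in terms of the
    common conductances \<open>a\<close>, so that energies of different subnetworks can be
    added.\<close>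
  have "\<exists>r. res_G (Es l) (conductance W u s (x l) (y l)) (x l) (y l) = ereal r \<and> 0 \<le> r \<and>
      (\<forall>f. q l * (f (x l) - f (y l))\<^sup>2 \<le> r * energy (Es l) a f f)" if l: "l \<in> {1..n}" for l
  proof -
    let ?c = "conductance W u s (x l) (y l)"
    have c: "0 < ?c e" if "e \<in> Es l" for e
      using a_pos[OF l that] q_pos[of l] by (simp add: cond)
    then have "{e \<in> Es l. 0 < ?c e} = Es l"
      by auto
    then have conn: "(x l, y l) \<in> (edge_adj {e \<in> Es l. 0 < ?c e})\<^sup>*"
      using Es_connected[OF l] Es_ends[OF l] unfolding graph_connected_def by metis
    obtain v where v: "eff_res (\<Union>(Es l)) (Es l) ?c (x l) (y l) = ereal (v (x l) - v (y l))"
      "energy (Es l) ?c v v = v (x l) - v (y l)"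
      "\<And>f. (f (x l) - f (y l))\<^sup>2 \<le> (v (x l) - v (y l)) * energy (Es l) ?c f f"
      by (rule eff_res_finite[OF order.refl _ _ _ conn]) (use Es_ends[OF l] c in \<open>auto intro: less_imp_le\<close>)
    have "0 \<le> v (x l) - v (y l)"
      using energy_nonneg[of "Es l" ?c v] c v(2) by (simp add: less_imp_le)
    moreover have "q l * (f (x l) - f (y l))\<^sup>2 \<le> (v (x l) - v (y l)) * energy (Es l) a f f" for f
    proof -
      have "energy (Es l) ?c f f = (1 / q l) * energy (Es l) a f f"
        unfolding energy_scale[symmetric] by (rule energy_cong) (rule cond)
      then have "(f (x l) - f (y l))\<^sup>2 \<le> (v (x l) - v (y l)) * energy (Es l) a f f / q l"
        using v(3)[of f] by simp
      then show ?thesis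
        using q_pos[of l] by (simp add: pos_le_divide_eq mult.commute)
    qed
    ultimately show ?thesis
      using v(1) unfolding res_G_def by blast
  qed
  then obtain r where r: "\<And>l. l \<in> {1..n} \<Longrightarrow>
      res_G (Es l) (conductance W u s (x l) (y l)) (x l) (y l) = ereal (r l)"
    "\<And>l. l \<in> {1..n} \<Longrightarrow> 0 \<le> r l"
    "\<And>l f. l \<in> {1..n} \<Longrightarrow> q l * (f (x l) - f (y l))\<^sup>2 \<le> r l * energy (Es l) a f f"
    by metis
  have mr: "m {x l, y l} * r l < 1" if "l \<in> {1..n}" for l
    using res_bound[OF that] by (simp add: r(1)[OF that] one_ereal_def)

  define \<E> where "\<E> = (\<lambda>e v. energy (Es (ix e)) a (ext v) (ext v))"
  have E_nonneg: "0 \<le> \<E> e v" if "e \<in> T" for e v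
    using T_cases[OF that] less_imp_le[OF a_pos] by (auto simp: \<E>_def ix intro!: energy_nonneg)
  have E_sum: "(\<Sum>e\<in>T. \<E> e v) \<le> v \<bullet> (D_mat h t W u *v v)" for v
  proof -
    let ?g = "\<lambda>e. W e * exp (ext u (h e) + ext u (t e)) * (ext v (h e) - ext v (t e))\<^sup>2"
    have "(\<Sum>e\<in>T. \<E> e v) = (\<Sum>l=1..n. \<E> (ed l) v)"
      by (rule sum.reindex_bij_betw[OF ed_bij, symmetric])
    also have "\<dots> = (\<Sum>l=1..n. sum ?g (Es l))"
    proof (rule sum.cong[OF refl])
      fix l assume l: "l \<in> {1..n}"
      have "energy (Es l) a (ext v) (ext v) = sum ?g (Es l)"
      proof (rule energy_sum_edges)
        show "card e = 2" if "e \<in> Es l" for e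
          using Es_all[OF l] that by (auto simp: all_edges_def)
        fix i j assume ij: "{i, j} \<in> Es l"
        then have "{i, j} \<in> all_edges"
          using Es_all[OF l] by auto
        then show "?g {i, j} = a {i, j} * (ext v i - ext v j)\<^sup>2"
          using orientation_ends[OF orient, of i j] all_edges_neq[of i j]
          by (auto simp: a_def power2_commute add.commute)
      qed
      then show "\<E> (ed l) v = sum ?g (Es l)"
        by (simp add: \<E>_def ix[OF l])
    qed
    \<comment> \<open>Disjointness of the \<open>Es l\<close> ensures that no edge is charged twice;
      all other edges of the complete graph contribute nonnegatively.\<close>
    also have "\<dots> = sum ?g (\<Union>l\<in>{1..n}. Es l)"
      by (rule sum.UNION_disjoint[symmetric]) (use disj in \<open>auto simp: disjoint_family_on_def\<close>)
    also have "\<dots> \<le> sum ?g all_edges"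
    proof (rule sum_mono2)
      show "(\<Union>l\<in>{1..n}. Es l) \<subseteq> all_edges"
        using Es_all by blast
    qed (simp_all add: W_nonneg)
    finally show ?thesis
      by (simp only: D_mat_inner)
  qed
  have col: "column e P \<bullet> v = sqrt (Q_entry h t u s e) * (ext v (h (ends e)) - ext v (t (ends e)))" for e v
  proof -
    have "column e P = sqrt (Q_entry h t u s e) *\<^sub>R column e (F_mat h t)"
      by (simp add: P_def sqrtQ_mat_def diag_def matrix_matrix_mult_def column_def vec_eq_iff
          if_distrib mult.commute cong: if_cong)
    then show ?thesis
      by (simp add: column_F_mat)
  qed
  have bound: "(column e P \<bullet> v)\<^sup>2 \<le> r (ix e) * \<E> e v" if e: "e \<in> T" for e v
  proof -
    obtain l where l: "l \<in> {1..n}" "e = ed l"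
      using T_cases[OF e] by blast
    have "(column e P \<bullet> v)\<^sup>2 = q l * (ext v (x l) - ext v (y l))\<^sup>2"
      using orientation_ends[OF orient xy(1)[OF l(1)]] q_pos[of l]
      by (auto simp: col l(2) power_mult_distrib Q_ed[OF l(1)] ends_ed[OF l(1)] power2_commute)
    then show ?thesis
      using r(3)[OF l(1), of "ext v"] by (simp add: \<E>_def l(2) ix[OF l(1)])
  qed
  have r_nonneg: "0 \<le> r (ix e)" if "e \<in> T" for e
    using T_cases[OF that] r(2) ix by auto
  have mT: "0 \<le> m (ends e) \<and> m (ends e) * r (ix e) < 1" if "e \<in> T" for e
    using T_cases[OF that] mr xy(2) ix ends_ed by (auto intro: less_imp_le)
  \<comment> \<open>Off \<open>T\<close> the value of \<open>m\<close> is nonnegative but not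
    positive, hence 0.\<close>
  have M: "M_mat m = diag (\<lambda>e. if e \<in> T then m (ends e) else 0)"
    unfolding M_mat_def
    by (rule arg_cong[of _ _ diag]) (use m_nonneg[OF ends_edges] in \<open>auto simp: T_def fun_eq_iff intro: antisym\<close>)
  note D_pd = D_mat_pos_definite[OF W_nonneg G_plus_connected orient, of u]
  have "sqrtQ_mat h t u s ** M_mat m ** sqrtQ_mat h t u s = M_mat m ** Q_mat h t u s"
  proof -
    have "0 \<le> Q_entry h t u s e" for e
      by (simp add: Q_entry_def B_pos less_imp_le)
    then show ?thesis
      by (simp add: sqrtQ_mat_def M_mat_def Q_mat_def diag_mult_diag mult.commute mult.left_commute)
  qed
  then have "P ** M_mat m ** transpose P
      = F_mat h t ** M_mat m ** Q_mat h t u s ** transpose (F_mat h t)"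
    by (simp add: P_def matrix_transpose_mul sqrtQ_mat_def matrix_mul_assoc)
       (simp add: matrix_mul_assoc[symmetric])
  then have pd: "pos_definite (D_mat h t W u - F_mat h t ** M_mat m ** Q_mat h t u s ** transpose (F_mat h t))"
    using pos_definite_diff[where P = P, OF D_pd E_nonneg E_sum bound mT] by (simp add: M)
  have "G_mat h t W u s = transpose P ** matrix_inv (D_mat h t W u) ** P"
    by (simp add: G_mat_def P_def matrix_transpose_mul sqrtQ_mat_def matrix_mul_assoc)
  then have "(\<Prod>e\<in>T. 1 - m (ends e) * r (ix e)) \<le> det (mat 1 - M_mat m ** G_mat h t W u s)"
    using det_lower_bound[where P = P, OF D_pd E_nonneg E_sum bound r_nonneg mT] by (simp add: M)
  moreover have "(\<Prod>e\<in>T. 1 - m (ends e) * r (ix e)) = (\<Prod>l=1..n. 1 - m {x l, y l} * r l)"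
    unfolding prod.reindex_bij_betw[OF ed_bij, symmetric]
    by (rule prod.cong) (simp_all add: ix ends_ed)
  ultimately show thesis
    using that[OF r(1) mr pd] by simp
qed

section \<open>Extended real bounds, deletion of \<rho> and monotonicity\<close>

theorem theorem2p10:
  fixes W m :: "'v::finite option set \<Rightarrow> real"
    and \<delta> :: "'v option set \<Rightarrow> ereal"
    and h t :: "'v option set \<Rightarrow> 'v option"
    and n :: nat
    and x y :: "nat \<Rightarrow> 'v option"
    and Es :: "nat \<Rightarrow> 'v option set set"
  assumes W_nonneg: "\<And>e. e \<in> all_edges \<Longrightarrow> 0 \<le> W e"
    and G_plus_connected: "graph_connected UNIV (pos_edges W)"
    and m_nonneg: "\<And>e. e \<in> all_edges \<Longrightarrow> 0 \<le> m e"
    and orient: "orientation h t"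
    and enum: "bij_betw (\<lambda>l. {x l, y l}) {1..n} {e \<in> all_edges. 0 < m e}"
    and disj: "disjoint_family_on Es {1..n}"
    and Es_subset: "\<And>l. l \<in> {1..n} \<Longrightarrow> Es l \<subseteq> pos_edges W"
    and Es_connected: "\<And>l. l \<in> {1..n} \<Longrightarrow> graph_connected (\<Union>(Es l)) (Es l)"
    and Es_ends: "\<And>l. l \<in> {1..n} \<Longrightarrow> x l \<in> \<Union>(Es l) \<and> y l \<in> \<Union>(Es l)"
    and \<delta>_pos: "\<And>e. e \<in> all_edges \<Longrightarrow> 0 < \<delta> e"
    and res_bound: "\<And>u s l. (u, s) \<in> U_set \<delta> \<Longrightarrow> l \<in> {1..n} \<Longrightarrow>
        ereal (m {x l, y l}) * res_G (Es l) (conductance W u s (x l) (y l)) (x l) (y l) < 1"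
  shows "(\<forall>u s. (u, s) \<in> U_set \<delta> \<longrightarrow>
        pos_definite (D_mat h t W u
          - F_mat h t ** M_mat m ** Q_mat h t u s ** transpose (F_mat h t)) \<and>
        ereal (det (mat 1 - M_mat m ** G_mat h t W u s)) \<ge>
          (\<Prod>l = 1..n. 1 - ereal (m {x l, y l}) *
             res_G (Es l) (conductance W u s (x l) (y l)) (x l) (y l)) \<and>
        (\<forall>S \<subseteq> {l \<in> {1..n}. None \<notin> {x l, y l}}.
          card {l \<in> S. ereal (m {x l, y l}) *
              res_G' (Es l) (conductance W u s (x l) (y l)) (x l) (y l) > 1} \<le> 1 \<longrightarrow>
          ereal (det (mat 1 - M_mat m ** G_mat h t W u s)) \<ge>
            (\<Prod>l = 1..n. 1 - ereal (m {x l, y l}) *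
               (if l \<in> S
                then res_G' (Es l) (conductance W u s (x l) (y l)) (x l) (y l)
                else res_G (Es l) (conductance W u s (x l) (y l)) (x l) (y l))))) \<and>
      (\<forall>l \<in> {1..n}. \<forall>c c'. (\<forall>e \<in> Es l. 0 \<le> c e \<and> c e \<le> c' e) \<longrightarrow>
        res_G (Es l) c' (x l) (y l) \<le> res_G (Es l) c (x l) (y l))"
proof (intro conjI allI impI ballI)
  fix u s assume us: "(u, s) \<in> U_set \<delta>"
  let ?c = "\<lambda>l. conductance W u s (x l) (y l)"
  let ?R = "\<lambda>l. res_G (Es l) (?c l) (x l) (y l)"
  let ?R' = "\<lambda>l. res_G' (Es l) (?c l) (x l) (y l)"
  obtain r where r: "\<And>l. l \<in> {1..n} \<Longrightarrow> ?R l = ereal (r l)"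
    and mr: "\<And>l. l \<in> {1..n} \<Longrightarrow> m {x l, y l} * r l < 1"
    and pd: "pos_definite (D_mat h t W u - F_mat h t ** M_mat m ** Q_mat h t u s ** transpose (F_mat h t))"
    and det: "(\<Prod>l=1..n. 1 - m {x l, y l} * r l) \<le> det (mat 1 - M_mat m ** G_mat h t W u s)"
    by (rule det_ge_prod_resistances[OF W_nonneg G_plus_connected m_nonneg orient enum disj Es_subset Es_connected
          Es_ends res_bound[OF us]]) (assumption | rule that | blast)+
  show "pos_definite (D_mat h t W u - F_mat h t ** M_mat m ** Q_mat h t u s ** transpose (F_mat h t))"
    by (rule pd)
  have R: "1 - ereal (m {x l, y l}) * ?R l = ereal (1 - m {x l, y l} * r l)" if "l \<in> {1..n}" for l
    by (simp add: r[OF that] one_ereal_def)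
  have "(\<Prod>l=1..n. 1 - ereal (m {x l, y l}) * ?R l) = (\<Prod>l=1..n. ereal (1 - m {x l, y l} * r l))"
    by (rule prod.cong[OF refl]) (rule R)
  then show "(\<Prod>l=1..n. 1 - ereal (m {x l, y l}) * ?R l) \<le> ereal (det (mat 1 - M_mat m ** G_mat h t W u s))"
    using det by (simp add: prod_ereal)
  fix S
  assume S: "S \<subseteq> {l \<in> {1..n}. None \<notin> {x l, y l}}"
    and card: "card {l \<in> S. 1 < ereal (m {x l, y l}) * ?R' l} \<le> 1"
  have m: "0 \<le> m {x l, y l}" if "l \<in> {1..n}" for l
    using bij_betwE[OF enum] that m_nonneg by auto
  \<comment> \<open>Deleting \<rho> is Rayleigh monotonicity with unchanged conductances on a
    smaller network; both endpoints remain since \<open>l \<in> S\<close> excludes pinning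
    edges.\<close>
  have RR': "?R l \<le> ?R' l" if "l \<in> S" for l
    unfolding res_G_def res_G'_def
  proof (rule eff_res_mono)
    have l: "l \<in> {1..n}" "None \<notin> {x l, y l}"
      using S that by auto
    show "x l \<in> \<Union>(Es l) - {None}"
      using Es_ends[OF l(1)] l(2) by (auto simp: eq_commute[of None])
    show "y l \<in> \<Union>(Es l) - {None}"
      using Es_ends[OF l(1)] l(2) by (auto simp: eq_commute[of None])
    have c: "0 \<le> ?c l e" if "e \<in> Es l" for e
      using Es_subset[OF l(1)] that by (auto simp: conductance_def pos_edges_def B_pos less_imp_le)
    then show "0 \<le> ?c l e" if "e \<in> Es l" for e
      using that .
    show "0 \<le> ?c l e \<and> ?c l e \<le> ?c l e" if "e \<in> {e \<in> Es l. None \<notin> e}" for e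
      using c that by auto
  qed auto
  let ?f = "\<lambda>l. 1 - ereal (m {x l, y l}) * (if l \<in> S then ?R' l else ?R l)"
  \<comment> \<open>These are the factors made negative, possibly minus infinity, by the larger
    resistances. The cardinality assumption prevents two of them from multiplying to a positive
    number.\<close>
  let ?K = "{l \<in> S. 1 < ereal (m {x l, y l}) * ?R' l}"
  have "prod ?f {1..n} \<le> ereal (\<Prod>l=1..n. 1 - m {x l, y l} * r l)"
  proof (rule prod_ereal_le[where K = ?K])
    show "?K \<subseteq> {1..n}"
      using S by auto
    show "card ?K \<le> 1"
      by (rule card)
    show "?f l \<le> 0" if "l \<in> ?K" for l
      using that by (simp add: one_minus_ereal_le_0)
    show "0 \<le> 1 - m {x l, y l} * r l" if "l \<in> {1..n}" for l
      using mr[OF that] by simp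
    show "0 \<le> ?f l" if "l \<in> {1..n} - ?K" for l
    proof (cases "l \<in> S")
      case True
      then have "ereal (m {x l, y l}) * ?R' l \<le> 1"
        using that by auto
      then show ?thesis
        using True by (simp add: ereal_diff_positive)
    next
      case False
      then show ?thesis
        using that mr[of l] by (simp add: R)
    qed
    show "?f l \<le> ereal (1 - m {x l, y l} * r l)" if "l \<in> {1..n} - ?K" for l
    proof -
      have l: "l \<in> {1..n}"
        using that by simp
      \<comment> \<open>Because \<open>m\<close> is nonnegative, passing to the larger resistance
        can only lower the factor.\<close>
      have "?f l \<le> 1 - ereal (m {x l, y l}) * ?R l"
        using RR'[of l] m[OF l] by (auto intro!: ereal_minus_mono ereal_mult_left_mono)
      then show ?thesis
        unfolding R[OF l] .
    qed
  qed simp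
  also have "\<dots> \<le> ereal (det (mat 1 - M_mat m ** G_mat h t W u s))"
    using det by simp
  finally show "prod ?f {1..n} \<le> ereal (det (mat 1 - M_mat m ** G_mat h t W u s))" .
next
  fix l and c c' :: "'v option set \<Rightarrow> real"
  assume l: "l \<in> {1..n}" and c: "\<forall>e\<in>Es l. 0 \<le> c e \<and> c e \<le> c' e"
  show "res_G (Es l) c' (x l) (y l) \<le> res_G (Es l) c (x l) (y l)"
    unfolding res_G_def
  proof (rule eff_res_mono)
    show "0 \<le> c' e" if "e \<in> Es l" for e
      using bspec[OF c that] by linarith
  qed (use c Es_ends[OF l] in auto)
qed

end
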